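(* Let $(c,p)\in\mathfrak{C}_+\times(\bar{\mathfrak{P}}_+\setminus\{0\})$. Then there exists a unique pair $(\hat c,\hat q)\in\partial\mathfrak{C}_+\times(\bar{\mathfrak{P}}_+\setminus\{0\})$ such that $$c_k=\int_K\alpha_k\frac{P}{\hat Q}\,dx+\hat c_k,\qquad k=1,2,\dots,n,$$ where $$\hat c_k=\int_K\alpha_k\,d\hat\mu,\qquad k=1,2,\dots,n,$$ for some (not necessarily unique) singular bounded nonnegative measure $d\hat\mu$ on $K$ whose support is contained in the set of zeros of $\hat Q$, i.e. $\mathrm{supp}(d\hat\mu)\subset\{x\in K\mid\hat Q(x)=0\}$. The vector $\hat q$ is the unique minimizer over $\bar{\mathfrak{P}}_+$ of the functional $\mathbb{J}^c_p(q)=\langle c,q\rangle-\int_K P\log Q\,dx$.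
   Context: $K\subset\mathbb{R}^d$ is a compact set with $d$-dimensional (nonempty) interior whose closure is precisely $K$; $dx$ is Lebesgue measure. $\alpha_1,\dots,\alpha_n$ are real-valued, continuous, linearly independent functions on $K$. For $p,q,\hat q\in\mathbb{R}^n$ write $P(x)=\sum_{k=1}^n p_k\alpha_k(x)$, and likewise $Q$, $\hat Q$ for $q$, $\hat q$. $\mathfrak{P}_+$ is the set of $p\in\mathbb{R}^n$ such that $P(x)>0$ for all $x\in K$; $\bar{\mathfrak{P}}_+$ is its closure. Standing assumption: for every $p\in\bar{\mathfrak{P}}_+\setminus\{0\}$ the zero set of $P$ in $K$ has Lebesgue measure zero. With $\langle c,p\rangle=\sum_{k=1}^n c_kp_k$, let $\mathfrak{C}_+=\{c\in\mathbb{R}^n\mid \langle c,p\rangle>0 \text{ for all } p\in\bar{\mathfrak{P}}_+\setminus\{0\}\}$, with closure $\bar{\mathfrak{C}}_+$ and boundary $\partial\mathfrak{C}_+=\bar{\mathfrak{C}}_+\setminus\mathfrak{C}_+$. The functional $\mathbb{J}^c_p$ is regarded as a map $\bar{\mathfrak{P}}_+\to\mathbb{R}\cup\{\infty\}$ (with $-\log 0=+\infty$). "Singular" means singular with respect to Lebesgue measure; the zero measure is allowed. Measures are Borel measures on $K$. *)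

theory Defs
  imports "HOL-Analysis.Analysis"
begin

text \<open>
  The functions \<open>\<alpha>\<^sub>1, \<dots>, \<alpha>\<^sub>n\<close> are a family \<open>\<alpha> :: 'n \<Rightarrow> real^'d \<Rightarrow> real\<close> indexed by a finite type;
  only their values on \<open>K\<close> matter. The pairing of coefficient vectors is the inner product \<open>\<bullet>\<close>.
\<close>

definition lin_indep_on :: "'a set \<Rightarrow> ('n::finite \<Rightarrow> 'a \<Rightarrow> real) \<Rightarrow> bool" where
  "lin_indep_on K \<alpha> \<longleftrightarrow>
     (\<forall>a::real^'n. (\<forall>x\<in>K. (\<Sum>k\<in>UNIV. a $ k * \<alpha> k x) = 0) \<longrightarrow> a = 0)"

definition gen_poly :: "('n::finite \<Rightarrow> 'a \<Rightarrow> real) \<Rightarrow> real^'n \<Rightarrow> 'a \<Rightarrow> real" where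
  "gen_poly \<alpha> p x = (\<Sum>k\<in>UNIV. p $ k * \<alpha> k x)"

definition pos_cone :: "'a set \<Rightarrow> ('n::finite \<Rightarrow> 'a \<Rightarrow> real) \<Rightarrow> (real^'n) set" where
  "pos_cone K \<alpha> = {p. \<forall>x\<in>K. gen_poly \<alpha> p x > 0}"

definition dual_cone :: "'a set \<Rightarrow> ('n::finite \<Rightarrow> 'a \<Rightarrow> real) \<Rightarrow> (real^'n) set" where
  "dual_cone K \<alpha> = {c. \<forall>p \<in> closure (pos_cone K \<alpha>) - {0}. c \<bullet> p > 0}"

definition dual_cone_boundary :: "'a set \<Rightarrow> ('n::finite \<Rightarrow> 'a \<Rightarrow> real) \<Rightarrow> (real^'n) set" where
  "dual_cone_boundary K \<alpha> = closure (dual_cone K \<alpha>) - dual_cone K \<alpha>"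

text \<open>Lebesgue measure on the Borel subsets of \<open>K\<close>.\<close>

abbreviation leb_on :: "(real^'d) set \<Rightarrow> (real^'d) measure" where
  "leb_on K \<equiv> restrict_space lborel K"

definition mutually_singular :: "'a measure \<Rightarrow> 'a measure \<Rightarrow> bool" where
  "mutually_singular M N \<longleftrightarrow>
     sets M = sets N \<and>
     (\<exists>A\<in>sets M. emeasure M (space M - A) = 0 \<and> emeasure N A = 0)"

text \<open>The neighbourhoods of \<open>x\<close> are relatively open in \<open>space M\<close>.\<close>

definition measure_supp :: "'a::topological_space measure \<Rightarrow> 'a set" where
  "measure_supp M =
     {x \<in> space M. \<forall>U. open U \<and> x \<in> U \<longrightarrow> emeasure M (U \<inter> space M) > 0}"

text \<open>
  The Lebesgue integral of an extended-real function, as the difference of the integrals of its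
  positive and negative parts (\<open>e2ennreal\<close> sends negative numbers to \<open>0\<close>). It is meaningful as
  soon as one of the two parts is finite.
\<close>

definition ereal_integral :: "'a measure \<Rightarrow> ('a \<Rightarrow> ereal) \<Rightarrow> ereal" where
  "ereal_integral M f =
     enn2ereal (\<integral>\<^sup>+x. e2ennreal (f x) \<partial>M) - enn2ereal (\<integral>\<^sup>+x. e2ennreal (- f x) \<partial>M)"

definition elog :: "real \<Rightarrow> ereal" where
  "elog t = (if t > 0 then ereal (ln t) else -\<infinity>)"

text \<open>
  The functional \<open>\<langle>c,q\<rangle> - \<integral>\<^sub>K P log Q dx\<close>, meant for \<open>p\<close> and \<open>q\<close> in the closure of the
  cone of positive generalized polynomials. There the positive part of \<open>P log Q\<close> is bounded, so
  the value is never \<open>-\<infinity>\<close>. The product \<open>0 * \<infinity> = 0\<close> of \<open>ereal\<close> occurs only on the zeros of \<open>P\<close>.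
\<close>

definition J_fun ::
  "(real^'d) set \<Rightarrow> ('n::finite \<Rightarrow> real^'d \<Rightarrow> real) \<Rightarrow> real^'n \<Rightarrow> real^'n \<Rightarrow> real^'n \<Rightarrow> ereal" where
  "J_fun K \<alpha> c p q =
     ereal (c \<bullet> q) - ereal_integral (leb_on K) (\<lambda>x. ereal (gen_poly \<alpha> p x) * elog (gen_poly \<alpha> q x))"

text \<open>
  The integrability condition expresses that the integrals of \<open>\<alpha>\<^sub>k P / Q\<close> exist; without
  it the Bochner integral would default to \<open>0\<close>. The integrand gets the value \<open>0\<close> at the zeros
  of \<open>Q\<close>. The integrals against \<open>\<mu>\<close> always exist, as the \<open>\<alpha>\<^sub>k\<close> are continuous on
  the compact set \<open>K\<close> and \<open>\<mu>\<close> is finite.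
\<close>

definition moment_solution ::
  "(real^'d) set \<Rightarrow> ('n::finite \<Rightarrow> real^'d \<Rightarrow> real) \<Rightarrow> real^'n \<Rightarrow> real^'n \<Rightarrow> real^'n \<Rightarrow> real^'n \<Rightarrow> bool"
where
  "moment_solution K \<alpha> c p c' q \<longleftrightarrow>
     c' \<in> dual_cone_boundary K \<alpha> \<and>
     q \<in> closure (pos_cone K \<alpha>) - {0} \<and>
     (\<forall>k. integrable (leb_on K) (\<lambda>x. \<alpha> k x * (gen_poly \<alpha> p x / gen_poly \<alpha> q x)) \<and>
          c $ k = (\<integral>x. \<alpha> k x * (gen_poly \<alpha> p x / gen_poly \<alpha> q x) \<partial>leb_on K) + c' $ k) \<and>
     (\<exists>\<mu>. sets \<mu> = sets (restrict_space borel K) \<and> finite_measure \<mu> \<and>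
          mutually_singular \<mu> (leb_on K) \<and>
          measure_supp \<mu> \<subseteq> {x\<in>K. gen_poly \<alpha> q x = 0} \<and>
          (\<forall>k. c' $ k = (\<integral>x. \<alpha> k x \<partial>\<mu>)))"

end

theory Submission
  imports Defs
begin

text \<open>
  If \<open>(c', q')\<close> solves the moment equations, then \<open>\<langle>c', q'\<rangle> = 0\<close>, as the measure sits on the zeros
  of \<open>Q'\<close>, and \<open>c'\<close> is nonnegative on the closed positive cone; by concavity of the logarithm
  \<open>q'\<close> is then the strict minimizer of the functional, which gives uniqueness. For existence, \<open>q'\<close>
  maximizes \<open>\<integral> P log Q\<close> on the compact slice \<open>\<langle>c, q\<rangle> = \<integral> P\<close> of the cone. The first-order condition
  says that \<open>c'\<close>, the difference of \<open>c\<close> and the moments of \<open>P / Q'\<close>, is nonnegative on the cone and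
  vanishes at \<open>q'\<close>. By strict separation it is a finite conic combination of points
  \<open>(\<alpha>\<^sub>1 x, \<dots>, \<alpha>\<^sub>n x)\<close>, i.e. the moment vector of a finite sum of point masses, and these
  must lie at zeros of \<open>Q'\<close>.
\<close>

section \<open>Generalized polynomials and the moment curve\<close>

definition moment_curve :: "('n::finite \<Rightarrow> 'a \<Rightarrow> real) \<Rightarrow> 'a \<Rightarrow> real^'n" where
  "moment_curve \<alpha> x = (\<chi> k. \<alpha> k x)"

lemma gen_poly_inner: "gen_poly \<alpha> p x = p \<bullet> moment_curve \<alpha> x"
  by (simp add: gen_poly_def moment_curve_def inner_vec_def)

lemma gen_poly_linear [simp]:
  "gen_poly \<alpha> (p + q) x = gen_poly \<alpha> p x + gen_poly \<alpha> q x"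
  "gen_poly \<alpha> (p - q) x = gen_poly \<alpha> p x - gen_poly \<alpha> q x"
  "gen_poly \<alpha> (t *\<^sub>R p) x = t * gen_poly \<alpha> p x"
  "gen_poly \<alpha> 0 x = 0"
  by (simp_all add: gen_poly_inner inner_add_left inner_diff_left)

text \<open>Nonemptiness of the positive cone is listed here because the closure and duality
  arguments start from a strictly positive polynomial; in the theorem the vector \<open>p\<close> in
  the closure guarantees it.\<close>

locale moment_cone =
  fixes K :: "(real^'d) set" and \<alpha> :: "'n::finite \<Rightarrow> real^'d \<Rightarrow> real"
  assumes compact_K: "compact K"
    and closure_interior_K: "closure (interior K) = K"
    and interior_K: "interior K \<noteq> {}"
    and continuous_\<alpha>: "\<And>k. continuous_on K (\<alpha> k)"
    and lin_indep: "lin_indep_on K \<alpha>"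
    and null_zeros: "\<And>r. r \<in> closure (pos_cone K \<alpha>) - {0} \<Longrightarrow> {x\<in>K. gen_poly \<alpha> r x = 0} \<in> null_sets lborel"
    and pos_cone_nonempty: "pos_cone K \<alpha> \<noteq> {}"
begin

section \<open>Continuity and integrability on the compact set\<close>

lemma continuous_moment_curve: "continuous_on K (moment_curve \<alpha>)"
  unfolding moment_curve_def by (intro continuous_on_vec_lambda continuous_\<alpha>)

lemma continuous_gen_poly: "continuous_on K (gen_poly \<alpha> p)"
  unfolding gen_poly_inner by (intro continuous_intros continuous_moment_curve)

lemma K_nonempty: "K \<noteq> {}"
  using interior_K interior_subset by auto

lemma K_borel [measurable]: "K \<in> sets borel"
  using compact_K by (simp add: borel_closed compact_imp_closed)

lemma space_leb_K [simp]: "space (leb_on K) = K"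
  by (simp add: space_restrict_space)

lemma measurable_continuous_K: "continuous_on K f \<Longrightarrow> f \<in> borel_measurable (leb_on K)"
  using borel_measurable_continuous_on_restrict[of K f]
  by (subst measurable_cong_sets[OF sets_restrict_space_cong[OF sets_lborel] refl])

lemma measurable_gen_poly [measurable]: "gen_poly \<alpha> p \<in> borel_measurable (leb_on K)"
  by (intro measurable_continuous_K continuous_gen_poly)

lemma bounded_continuous_K:
  fixes f :: "real^'d \<Rightarrow> real"
  assumes "continuous_on K f"
  obtains B where "B > 0" "\<And>x. x \<in> K \<Longrightarrow> \<bar>f x\<bar> \<le> B"
  using compact_imp_bounded[OF compact_continuous_image[OF assms compact_K]]
  by (auto simp: bounded_pos)

sublocale leb: finite_measure "leb_on K"
  using emeasure_compact_finite[OF compact_K]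
  by (auto intro!: finite_measureI simp: emeasure_restrict_space)

lemma integrable_continuous_mult:
  fixes h :: "real^'d \<Rightarrow> real"
  assumes f: "continuous_on K f" and h: "integrable (leb_on K) h"
  shows "integrable (leb_on K) (\<lambda>x. f x * h x)"
proof -
  obtain B where B: "B > 0" "\<And>x. x \<in> K \<Longrightarrow> \<bar>f x\<bar> \<le> B"
    using bounded_continuous_K[OF f] by blast
  show ?thesis
  proof (rule Bochner_Integration.integrable_bound)
    show "integrable (leb_on K) (\<lambda>x. B * h x)" using h by simp
    show "(\<lambda>x. f x * h x) \<in> borel_measurable (leb_on K)"
      using measurable_continuous_K[OF f] h by measurable
    show "AE x in leb_on K. norm (f x * h x) \<le> norm (B * h x)"
      using B by (intro AE_I2) (auto simp: abs_mult intro!: mult_right_mono)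
  qed
qed

lemma integrable_continuous_K:
  fixes f :: "real^'d \<Rightarrow> real"
  shows "continuous_on K f \<Longrightarrow> integrable (leb_on K) f"
  using integrable_continuous_mult[of f "\<lambda>_. 1"] by simp

section \<open>The closed positive cone and its dual\<close>

text \<open>Weak inequalities at the points of \<open>K\<close> cut out a closed set. Conversely,
  adding small positive multiples of a strictly positive polynomial moves a nonnegative one into the
  open cone.\<close>

lemma closure_pos_cone: "closure (pos_cone K \<alpha>) = {p. \<forall>x\<in>K. gen_poly \<alpha> p x \<ge> 0}"
proof
  have "closed (\<Inter>x\<in>K. {p. 0 \<le> p \<bullet> moment_curve \<alpha> x})"
    by (intro closed_INT ballI closed_Collect_le continuous_intros)
  also have "(\<Inter>x\<in>K. {p. 0 \<le> p \<bullet> moment_curve \<alpha> x}) = {p. \<forall>x\<in>K. gen_poly \<alpha> p x \<ge> 0}"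
    by (auto simp: gen_poly_inner)
  finally show "closure (pos_cone K \<alpha>) \<subseteq> {p. \<forall>x\<in>K. gen_poly \<alpha> p x \<ge> 0}"
    by (intro closure_minimal) (auto simp: pos_cone_def less_imp_le)
next
  obtain s where s: "s \<in> pos_cone K \<alpha>" using pos_cone_nonempty by blast
  show "{p. \<forall>x\<in>K. gen_poly \<alpha> p x \<ge> 0} \<subseteq> closure (pos_cone K \<alpha>)"
  proof
    fix p assume p: "p \<in> {p. \<forall>x\<in>K. gen_poly \<alpha> p x \<ge> 0}"
    have "(\<lambda>n. p + inverse (real (Suc n)) *\<^sub>R s) \<longlonglongrightarrow> p + 0 *\<^sub>R s"
      by (intro tendsto_intros LIMSEQ_inverse_real_of_nat)
    moreover have "p + inverse (real (Suc n)) *\<^sub>R s \<in> pos_cone K \<alpha>" for n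
      using p s by (auto simp: pos_cone_def intro!: add_nonneg_pos mult_pos_pos)
    ultimately show "p \<in> closure (pos_cone K \<alpha>)"
      unfolding closure_sequential
      by (intro exI[of _ "\<lambda>n. p + inverse (real (Suc n)) *\<^sub>R s"]) simp
  qed
qed

lemma pos_cone_lower_bound:
  assumes "r \<in> pos_cone K \<alpha>"
  obtains \<delta> where "\<delta> > 0" "\<And>x. x \<in> K \<Longrightarrow> gen_poly \<alpha> r x \<ge> \<delta>"
proof -
  obtain y where y: "y \<in> K" "\<And>x. x \<in> K \<Longrightarrow> gen_poly \<alpha> r y \<le> gen_poly \<alpha> r x"
    using continuous_attains_inf[OF compact_K K_nonempty continuous_gen_poly] by blast
  show thesis
    by (rule that[of "gen_poly \<alpha> r y"]) (use assms y in \<open>auto simp: pos_cone_def\<close>)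
qed

lemma AE_leb_K_iff: "(AE x in leb_on K. Q x) \<longleftrightarrow> (AE x in lborel. x \<in> K \<longrightarrow> Q x)"
  by (rule AE_restrict_space_iff) simp

text \<open>The standing assumption on zero sets enters here: a nonnegative polynomial with a null
  zero set is positive almost everywhere.\<close>

lemma AE_gen_poly_pos:
  assumes "q \<in> closure (pos_cone K \<alpha>) - {0}"
  shows "AE x in leb_on K. gen_poly \<alpha> q x > 0"
  unfolding AE_leb_K_iff
proof (rule AE_I'[OF null_zeros[OF assms]])
  show "{x \<in> space lborel. \<not> (x \<in> K \<longrightarrow> 0 < gen_poly \<alpha> q x)} \<subseteq> {x \<in> K. gen_poly \<alpha> q x = 0}"
    using assms by (auto simp: closure_pos_cone order.antisym)
qed

text \<open>The points of the interior where the two polynomials differ form an open null set, which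
  is empty. Density of the interior extends the equality to \<open>K\<close>, and linear
  independence yields equal coefficients.\<close>

lemma gen_poly_AE_eqD:
  assumes "AE x in leb_on K. gen_poly \<alpha> q x = gen_poly \<alpha> r x"
  shows "q = r"
proof -
  let ?D = "{x \<in> interior K. gen_poly \<alpha> (q - r) x \<noteq> 0}"
  have cont: "continuous_on (interior K) (gen_poly \<alpha> (q - r))"
    using continuous_gen_poly interior_subset continuous_on_subset by blast
  have "?D = interior K \<inter> gen_poly \<alpha> (q - r) -` (- {0})" by auto
  then have "open ?D"
    using continuous_open_preimage[OF cont open_interior, of "- {0}"] by auto
  moreover have "negligible ?D"
  proof -
    have "AE x in lborel. x \<in> K \<longrightarrow> gen_poly \<alpha> q x = gen_poly \<alpha> r x"
      using assms by (simp add: AE_leb_K_iff)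
    then have "AE x in lborel. x \<notin> ?D"
      by eventually_elim (use interior_subset in auto)
    with \<open>open ?D\<close> have "?D \<in> null_sets lborel" 
      by (subst AE_iff_null_sets) auto
    then show ?thesis
      by (simp add: negligible_iff_null_sets null_sets_completionI)
  qed
  ultimately have "?D = {}" using open_not_negligible by blast
  have "gen_poly \<alpha> (q - r) x = 0" if "x \<in> K" for x
  proof (rule continuous_constant_on_closure[where S = "interior K"])
    show "continuous_on (closure (interior K)) (gen_poly \<alpha> (q - r))"
      by (simp only: closure_interior_K continuous_gen_poly)
    show "x \<in> closure (interior K)" using that by (simp only: closure_interior_K)
    show "gen_poly \<alpha> (q - r) y = 0" if "y \<in> interior K" for y
      using that \<open>?D = {}\<close> by blast
  qed
  then have "q - r = 0"
    using lin_indep[unfolded lin_indep_on_def, rule_format, of "q - r"]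
    unfolding gen_poly_def by blast
  then show ?thesis by simp
qed

lemma dual_cone_closure_nonneg:
  assumes "c \<in> closure (dual_cone K \<alpha>)" "r \<in> closure (pos_cone K \<alpha>)"
  shows "c \<bullet> r \<ge> 0"
proof -
  have "closure (dual_cone K \<alpha>) \<subseteq> {c. c \<bullet> r \<ge> 0}"
  proof (rule closure_minimal)
    show "dual_cone K \<alpha> \<subseteq> {c. 0 \<le> c \<bullet> r}"
      using assms(2) by (cases "r = 0") (auto simp: dual_cone_def less_imp_le)
    show "closed {c. 0 \<le> c \<bullet> r}"
      by (intro closed_Collect_le continuous_intros)
  qed
  then show ?thesis using assms(1) by auto
qed

end

section \<open>Moments, extended integrals and supports of measures\<close>

lemma integral_gen_poly_mult:
  fixes h :: "'a \<Rightarrow> real" and \<alpha> :: "'n::finite \<Rightarrow> 'a \<Rightarrow> real"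
  assumes "\<And>k. integrable M (\<lambda>x. \<alpha> k x * h x)"
  shows "integrable M (\<lambda>x. gen_poly \<alpha> s x * h x)"
    and "(\<integral>x. gen_poly \<alpha> s x * h x \<partial>M) = s \<bullet> (\<chi> k. \<integral>x. \<alpha> k x * h x \<partial>M)"
  using assms
  by (simp_all add: gen_poly_def sum_distrib_right mult.assoc inner_vec_def)

text \<open>The integrable upper bound \<open>g\<close> makes the positive part finite, so only the
  negative part decides between a real value and \<open>-\<infinity>\<close>.\<close>

lemma ereal_integral_eq:
  fixes f g :: "'a \<Rightarrow> real"
  assumes f [measurable]: "f \<in> borel_measurable M"
    and F: "AE x in M. F x = ereal (f x)"
    and le: "AE x in M. f x \<le> g x" and g: "integrable M g"
  shows "ereal_integral M F = (if integrable M f then ereal (\<integral>x. f x \<partial>M) else - \<infinity>)"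
proof -
  have pos: "(\<integral>\<^sup>+x. e2ennreal (F x) \<partial>M) = (\<integral>\<^sup>+x. ennreal (f x) \<partial>M)"
    by (rule nn_integral_cong_AE) (use F in eventually_elim, simp)
  have neg: "(\<integral>\<^sup>+x. e2ennreal (- F x) \<partial>M) = (\<integral>\<^sup>+x. ennreal (- f x) \<partial>M)"
    by (rule nn_integral_cong_AE) (use F in eventually_elim, simp)
  have "(\<integral>\<^sup>+x. ennreal (f x) \<partial>M) \<le> (\<integral>\<^sup>+x. ennreal (norm (g x)) \<partial>M)"
    by (rule nn_integral_mono_AE) (use le in eventually_elim, auto intro!: ennreal_leI)
  also have "\<dots> < \<infinity>" using g by (simp add: integrable_iff_bounded)
  finally obtain a where a: "a \<ge> 0" "(\<integral>\<^sup>+x. ennreal (f x) \<partial>M) = ennreal a"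
    by (cases "\<integral>\<^sup>+x. ennreal (f x) \<partial>M") auto
  show ?thesis
  proof (cases "\<integral>\<^sup>+x. ennreal (- f x) \<partial>M")
    case (real b)
    then have "integrable M f" using a by (simp add: real_integrable_def)
    then show ?thesis
      using a real by (simp add: ereal_integral_def pos neg real_lebesgue_integral_def)
  next
    case top
    then have "\<not> integrable M f" by (simp add: real_integrable_def)
    then show ?thesis
      using a top by (simp add: ereal_integral_def pos neg)
  qed
qed

text \<open>The complement of the support is covered by open sets of measure zero; by the Lindelof
  property countably many of them suffice.\<close>

lemma AE_measure_supp:
  fixes M :: "'a::second_countable_topology measure"
  assumes sets: "\<And>U. open U \<Longrightarrow> U \<inter> space M \<in> sets M"
  shows "AE x in M. x \<in> measure_supp M"
proof -
  define F where "F = {U. open U \<and> emeasure M (U \<inter> space M) = 0}"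
  obtain F' where F': "F' \<subseteq> F" "countable F'" "\<Union>F' = \<Union>F"
    using Lindelof[of F] unfolding F_def by blast
  have "(\<Union>U\<in>F'. U \<inter> space M) \<in> null_sets M"
    using F' by (intro null_sets_UN' null_setsI) (auto simp: F_def intro: sets)
  then show ?thesis
  proof (rule AE_I')
    show "{x \<in> space M. x \<notin> measure_supp M} \<subseteq> (\<Union>U\<in>F'. U \<inter> space M)"
    proof
      fix x assume "x \<in> {x \<in> space M. x \<notin> measure_supp M}"
      then have "x \<in> space M" "x \<in> \<Union>F" by (auto simp: measure_supp_def F_def)
      then show "x \<in> (\<Union>U\<in>F'. U \<inter> space M)" using F'(3) by auto
    qed
  qed
qed

section \<open>Values of the functional on the closed cone\<close>

context moment_cone
begin

text \<open>For a strictly positive polynomial \<open>R\<close>, the product \<open>R * h\<close> is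
  a linear combination of the given integrands. Multiplying by the continuous function
  \<open>1 / R\<close> recovers \<open>h\<close>.\<close>

lemma integrable_of_moments:
  assumes "\<And>k. integrable (leb_on K) (\<lambda>x. \<alpha> k x * h x)"
  shows "integrable (leb_on K) h"
proof -
  obtain r \<delta> where r: "\<delta> > 0" "\<And>x. x \<in> K \<Longrightarrow> gen_poly \<alpha> r x \<ge> \<delta>"
    using pos_cone_nonempty pos_cone_lower_bound by blast
  then have nz: "\<forall>x\<in>K. gen_poly \<alpha> r x \<noteq> 0" by force
  then have "continuous_on K (\<lambda>x. inverse (gen_poly \<alpha> r x))"
    by (intro continuous_intros continuous_gen_poly)
  from integrable_continuous_mult[OF this integral_gen_poly_mult(1)[where \<alpha> = \<alpha> and s = r, OF assms]]
  show ?thesis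
    by (rule Bochner_Integration.integrable_cong[THEN iffD1, rotated -1]) (use nz in auto)
qed

lemma gen_poly_ln_le: "gen_poly \<alpha> p x * ln (gen_poly \<alpha> q x) \<le> gen_poly \<alpha> p x * gen_poly \<alpha> q x"
  if "p \<in> closure (pos_cone K \<alpha>)" "x \<in> K" "gen_poly \<alpha> q x > 0"
  using that by (intro mult_left_mono) (auto simp: closure_pos_cone intro: ln_le_minus_one[THEN order_trans])

text \<open>As \<open>Q\<close> is positive almost everywhere, \<open>elog\<close> may be replaced
  by \<open>ln\<close>; the bound of \<open>P ln Q\<close> by the continuous \<open>P Q\<close>
  excludes the value \<open>-\<infinity>\<close> of the functional.\<close>

lemma J_fun_eq:
  assumes p: "p \<in> closure (pos_cone K \<alpha>) - {0}" and q: "q \<in> closure (pos_cone K \<alpha>) - {0}"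
  shows "J_fun K \<alpha> c p q =
    (if integrable (leb_on K) (\<lambda>x. gen_poly \<alpha> p x * ln (gen_poly \<alpha> q x))
     then ereal (c \<bullet> q - (\<integral>x. gen_poly \<alpha> p x * ln (gen_poly \<alpha> q x) \<partial>leb_on K)) else \<infinity>)"
proof -
  have "ereal_integral (leb_on K) (\<lambda>x. ereal (gen_poly \<alpha> p x) * elog (gen_poly \<alpha> q x)) =
    (if integrable (leb_on K) (\<lambda>x. gen_poly \<alpha> p x * ln (gen_poly \<alpha> q x))
     then ereal (\<integral>x. gen_poly \<alpha> p x * ln (gen_poly \<alpha> q x) \<partial>leb_on K) else - \<infinity>)"
  proof (rule ereal_integral_eq)
    show "AE x in leb_on K. ereal (gen_poly \<alpha> p x) * elog (gen_poly \<alpha> q x) =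
       ereal (gen_poly \<alpha> p x * ln (gen_poly \<alpha> q x))"
      using AE_gen_poly_pos[OF q] by eventually_elim (simp add: elog_def)
    show "AE x in leb_on K. gen_poly \<alpha> p x * ln (gen_poly \<alpha> q x) \<le> gen_poly \<alpha> p x * gen_poly \<alpha> q x"
      using AE_gen_poly_pos[OF q] AE_space
      by eventually_elim (use p gen_poly_ln_le in auto)
    show "integrable (leb_on K) (\<lambda>x. gen_poly \<alpha> p x * gen_poly \<alpha> q x)"
      by (intro integrable_continuous_K continuous_intros continuous_gen_poly)
  qed measurable
  then show ?thesis by (simp add: J_fun_def)
qed

text \<open>Says that \<open>K\<close> is not a null set: otherwise any two coefficient vectors
  would give polynomials equal almost everywhere and would coincide.\<close>

lemma not_AE_False: "\<not> (AE x in leb_on K. False)"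
proof
  assume *: "AE x in leb_on K. False"
  have "q = r" for q r :: "real^'n" using * by (intro gen_poly_AE_eqD) auto
  from this[of 0 "\<chi> k. 1"] show False by (simp add: vec_eq_iff)
qed

text \<open>The integrand is \<open>-\<infinity>\<close> wherever \<open>P\<close> is positive,
  which is almost everywhere on a set of positive measure.\<close>

lemma J_fun_zero:
  assumes p: "p \<in> closure (pos_cone K \<alpha>) - {0}"
  shows "J_fun K \<alpha> c p 0 = \<infinity>"
proof -
  have AE: "AE x in leb_on K. ereal (gen_poly \<alpha> p x) * elog 0 = - \<infinity>"
    using AE_gen_poly_pos[OF p] by eventually_elim (simp add: elog_def)
  have "(\<integral>\<^sup>+x. e2ennreal (ereal (gen_poly \<alpha> p x) * elog 0) \<partial>leb_on K) = (\<integral>\<^sup>+x. 0 \<partial>leb_on K)"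
    by (rule nn_integral_cong_AE) (use AE in eventually_elim, simp only: e2ennreal_neg ereal_less_eq)
  moreover have "(\<integral>\<^sup>+x. e2ennreal (- (ereal (gen_poly \<alpha> p x) * elog 0)) \<partial>leb_on K) = (\<integral>\<^sup>+x. \<infinity> \<partial>leb_on K)"
    by (rule nn_integral_cong_AE) (use AE in eventually_elim, simp only: ereal_uminus_uminus e2ennreal_infty infinity_ennreal_def)
  moreover have "emeasure (leb_on K) K \<noteq> 0"
    using not_AE_False AE_iff_measurable[of K "leb_on K" "\<lambda>_. False"] sets.top[of "leb_on K"] by auto
  ultimately show ?thesis
    by (simp add: J_fun_def ereal_integral_def ennreal_top_mult zero_ereal_def[symmetric] zero_ennreal.rep_eq)
qed

section \<open>Strict minimality of a solution and uniqueness\<close>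

text \<open>By linearity \<open>c' \<bullet> q\<close> is the integral of \<open>Q\<close> against
  the singular measure, which is concentrated on its support and hence on the zeros of
  \<open>Q\<close>.\<close>

lemma moment_solution_inner_zero:
  assumes "moment_solution K \<alpha> c p c' q"
  shows "c' \<bullet> q = 0"
proof -
  obtain \<mu> where sets: "sets \<mu> = sets (restrict_space borel K)" and fin: "finite_measure \<mu>"
    and supp: "measure_supp \<mu> \<subseteq> {x\<in>K. gen_poly \<alpha> q x = 0}"
    and c': "\<And>k. c' $ k = (\<integral>x. \<alpha> k x \<partial>\<mu>)"
    using assms unfolding moment_solution_def by blast
  interpret \<mu>: finite_measure \<mu> by fact
  have space: "space \<mu> = K"
    using sets_eq_imp_space_eq[OF sets] by (simp add: space_restrict_space)
  have "integrable \<mu> (\<lambda>x. \<alpha> k x * 1)" for k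
  proof -
    obtain B where "\<And>x. x \<in> K \<Longrightarrow> \<bar>\<alpha> k x\<bar> \<le> B"
      using bounded_continuous_K[OF continuous_\<alpha>] by blast
    moreover have "\<alpha> k \<in> borel_measurable \<mu>"
      using borel_measurable_continuous_on_restrict[OF continuous_\<alpha>]
      by (subst measurable_cong_sets[OF sets refl])
    ultimately show ?thesis
      by (intro \<mu>.integrable_const_bound[of _ B] AE_I2) (auto simp: space)
  qed
  note integral_gen_poly_mult(2)[where \<alpha> = \<alpha> and s = q, OF this]
  moreover have "(\<integral>x. gen_poly \<alpha> q x * 1 \<partial>\<mu>) = (\<integral>x. 0 \<partial>\<mu>)"
  proof (rule integral_cong_AE)
    have "AE x in \<mu>. x \<in> measure_supp \<mu>"
      by (rule AE_measure_supp) (auto simp: space sets sets_restrict_space)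
    then show "AE x in \<mu>. gen_poly \<alpha> q x * 1 = 0"
      by eventually_elim (use supp in auto)
    show "(\<lambda>x. gen_poly \<alpha> q x * 1) \<in> borel_measurable \<mu>"
      using borel_measurable_continuous_on_restrict[OF continuous_gen_poly]
      by (subst measurable_cong_sets[OF sets refl]) simp
  qed simp
  ultimately show ?thesis
    by (simp add: c' inner_vec_def mult.commute)
qed

text \<open>
  Tangent line of \<open>ln\<close> at \<open>Q\<close>: the gap \<open>\<integral> P (R/Q - 1 - ln (R/Q))\<close> is nonnegative, and the
  linear part \<open>\<langle>c, r - q\<rangle> - \<integral> P (R - Q)/Q\<close> equals \<open>\<langle>c', r\<rangle> \<ge> 0\<close>.
\<close>

lemma moment_solution_strict_min:
  assumes sol: "moment_solution K \<alpha> c p c' q"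
    and p: "p \<in> closure (pos_cone K \<alpha>) - {0}"
    and r: "r \<in> closure (pos_cone K \<alpha>)" and "r \<noteq> q"
  shows "J_fun K \<alpha> c p q < J_fun K \<alpha> c p r"
proof -
  define P Q R where "P = gen_poly \<alpha> p" and "Q = gen_poly \<alpha> q" and "R = gen_poly \<alpha> r"
  have [measurable]: "P \<in> borel_measurable (leb_on K)" "Q \<in> borel_measurable (leb_on K)"
    "R \<in> borel_measurable (leb_on K)"
    by (simp_all add: P_def Q_def R_def)
  have q: "q \<in> closure (pos_cone K \<alpha>) - {0}" and c': "c' \<in> closure (dual_cone K \<alpha>)"
    and mom: "\<And>k. integrable (leb_on K) (\<lambda>x. \<alpha> k x * (P x / Q x))"
      "\<And>k. (\<integral>x. \<alpha> k x * (P x / Q x) \<partial>leb_on K) = (c - c') $ k"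
    using sol by (auto simp: moment_solution_def dual_cone_boundary_def P_def Q_def)
  have int: "integrable (leb_on K) (\<lambda>x. gen_poly \<alpha> s x * (P x / Q x))"
    "(\<integral>x. gen_poly \<alpha> s x * (P x / Q x) \<partial>leb_on K) = s \<bullet> (c - c')" for s
    using integral_gen_poly_mult[where \<alpha> = \<alpha> and s = s, OF mom(1)]
    by (simp_all only: mom(2) vec_lambda_eta)
  have int_h: "integrable (leb_on K) (\<lambda>x. P x / Q x)"
    using mom(1) by (rule integrable_of_moments)
  have posP: "AE x in leb_on K. P x > 0" and posQ: "AE x in leb_on K. Q x > 0"
    using AE_gen_poly_pos p q by (auto simp: P_def Q_def)
  have int_PQ: "integrable (leb_on K) (\<lambda>x. P x * Q x)"
    unfolding P_def Q_def by (intro integrable_continuous_K continuous_intros continuous_gen_poly)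
  \<comment> \<open>Applying \<open>ln t \<le> t - 1\<close> to \<open>Q\<close> and to
    \<open>1 / Q\<close> bounds the absolute value of \<open>ln Q\<close> by
    \<open>Q + 1 / Q\<close>, and both \<open>P Q\<close> and \<open>P / Q\<close> are
    integrable.\<close>
  have intQ: "integrable (leb_on K) (\<lambda>x. P x * ln (Q x))"
  proof (rule Bochner_Integration.integrable_bound)
    show "integrable (leb_on K) (\<lambda>x. P x * Q x + P x / Q x)"
      using int_PQ int_h by simp
    show "AE x in leb_on K. norm (P x * ln (Q x)) \<le> norm (P x * Q x + P x / Q x)"
      using posP posQ
    proof eventually_elim
      case (elim x)
      have "ln (Q x) \<le> Q x" "- ln (Q x) \<le> 1 / Q x"
        using ln_le_minus_one[of "Q x"] ln_le_minus_one[of "1 / Q x"] elim by (auto simp: ln_div)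
      then have "\<bar>ln (Q x)\<bar> \<le> Q x + 1 / Q x" using elim by (auto simp: abs_if intro: add_increasing add_increasing2)
      then have "P x * \<bar>ln (Q x)\<bar> \<le> P x * (Q x + 1 / Q x)" using elim by (intro mult_left_mono) auto
      then show ?case using elim by (simp add: abs_mult algebra_simps)
    qed
  qed measurable
  show ?thesis
  proof (cases "r \<noteq> 0 \<and> integrable (leb_on K) (\<lambda>x. P x * ln (R x))")
    case False
    then have "J_fun K \<alpha> c p r = \<infinity>"
      using J_fun_zero[OF p] J_fun_eq[OF p] r by (cases "r = 0") (auto simp: P_def R_def)
    then show ?thesis using J_fun_eq[OF p q] intQ by (auto simp: P_def Q_def)
  next
    case True
    then have r0: "r \<in> closure (pos_cone K \<alpha>) - {0}" and intR: "integrable (leb_on K) (\<lambda>x. P x * ln (R x))"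
      using r by auto
    have posR: "AE x in leb_on K. R x > 0" using AE_gen_poly_pos[OF r0] by (simp add: R_def)
    \<comment> \<open>The term \<open>Q x * (P x / Q x)\<close> is not simplified to
      \<open>P x\<close>, so that the moment identity \<open>int\<close> evaluates it in the same
      way as the term with \<open>R\<close>.\<close>
    define G where "G x = P x * ln (Q x) - P x * ln (R x) + (R x * (P x / Q x) - Q x * (P x / Q x))" for x
    have intG: "integrable (leb_on K) G"
      unfolding G_def using intQ intR int(1)[of r] int(1)[of q] by (simp add: R_def Q_def)
    have "(\<integral>x. G x \<partial>leb_on K) = (\<integral>x. P x * ln (Q x) \<partial>leb_on K) - (\<integral>x. P x * ln (R x) \<partial>leb_on K)
        + (r \<bullet> (c - c') - q \<bullet> (c - c'))"
      unfolding G_def using intQ intR int[of r] int[of q] by (simp add: R_def Q_def)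
    moreover have G: "AE x in leb_on K. 0 \<le> G x \<and> (G x = 0 \<longrightarrow> Q x = R x)"
      using posP posQ posR
    proof eventually_elim
      case (elim x)
      have eq: "G x = P x * (R x / Q x - 1 - ln (R x / Q x))"
        using elim by (simp add: G_def ln_div field_simps)
      have "ln (R x / Q x) \<le> R x / Q x - 1" using elim by (intro ln_le_minus_one) auto
      moreover have "R x / Q x = 1" if "ln (R x / Q x) = R x / Q x - 1"
        using elim that by (intro ln_eq_minus_one) auto
      ultimately show ?case using elim by (auto simp: eq)
    qed
    \<comment> \<open>Equality in the tangent inequality holds only at \<open>R / Q = 1\<close>, so
      a vanishing gap would give \<open>Q = R\<close> almost everywhere and thus
      \<open>q = r\<close>.\<close>
    moreover have "(\<integral>x. G x \<partial>leb_on K) \<noteq> 0"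
    proof
      assume "(\<integral>x. G x \<partial>leb_on K) = 0"
      then have "AE x in leb_on K. G x = 0"
        using G by (subst (asm) integral_nonneg_eq_0_iff_AE[OF intG]) auto
      then have "AE x in leb_on K. gen_poly \<alpha> q x = gen_poly \<alpha> r x"
        using G by eventually_elim (auto simp: Q_def R_def)
      then show False using gen_poly_AE_eqD \<open>r \<noteq> q\<close> by blast
    qed
    moreover have "(\<integral>x. G x \<partial>leb_on K) \<ge> 0"
      using G by (intro integral_nonneg_AE) auto
    moreover have "c' \<bullet> q = 0" "c' \<bullet> r \<ge> 0"
      using moment_solution_inner_zero[OF sol] dual_cone_closure_nonneg[OF c' r] by auto
    ultimately show ?thesis
      using J_fun_eq[OF p q, of c] J_fun_eq[OF p r0, of c] intQ intR
      by (simp add: P_def Q_def R_def inner_diff_right inner_commute)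
  qed
qed

text \<open>Two solutions with different \<open>q\<close> would each have a strictly smaller value
  of the functional than the other. Once \<open>q\<close> is fixed, the moment equations determine
  the remainder.\<close>

lemma moment_solution_unique:
  assumes sol: "moment_solution K \<alpha> c p c1 q1" "moment_solution K \<alpha> c p c2 q2"
    and p: "p \<in> closure (pos_cone K \<alpha>) - {0}"
  shows "c1 = c2 \<and> q1 = q2"
proof -
  have "q1 = q2"
  proof (rule ccontr)
    assume "q1 \<noteq> q2"
    then show False
      using moment_solution_strict_min[OF sol(1) p, of q2] moment_solution_strict_min[OF sol(2) p, of q1] sol
      by (force simp: moment_solution_def)
  qed
  moreover have "c1 $ k = c2 $ k" for k
  proof -
    have "c $ k = (\<integral>x. \<alpha> k x * (gen_poly \<alpha> p x / gen_poly \<alpha> q1 x) \<partial>leb_on K) + c1 $ k"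
      "c $ k = (\<integral>x. \<alpha> k x * (gen_poly \<alpha> p x / gen_poly \<alpha> q2 x) \<partial>leb_on K) + c2 $ k"
      using sol by (auto simp: moment_solution_def)
    then show ?thesis using \<open>q1 = q2\<close> by simp
  qed
  ultimately show ?thesis by (simp add: vec_eq_iff)
qed

section \<open>Functionals nonnegative on the cone as sums of point masses\<close>

text \<open>The cone is open around \<open>s\<close>, so \<open>s - e *\<^sub>R c\<close> still lies
  in it for small \<open>e > 0\<close>; pairing with \<open>c\<close> gives
  \<open>c \<bullet> s \<ge> e * (c \<bullet> c)\<close>.\<close>

lemma pos_cone_inner_pos:
  assumes nonneg: "\<And>r. r \<in> pos_cone K \<alpha> \<Longrightarrow> c \<bullet> r \<ge> 0" and "c \<noteq> 0" and s: "s \<in> pos_cone K \<alpha>"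
  shows "c \<bullet> s > 0"
proof -
  obtain \<delta> where \<delta>: "\<delta> > 0" "\<And>x. x \<in> K \<Longrightarrow> gen_poly \<alpha> s x \<ge> \<delta>"
    using pos_cone_lower_bound[OF s] by blast
  obtain B where B: "B > 0" "\<And>x. x \<in> K \<Longrightarrow> \<bar>gen_poly \<alpha> c x\<bar> \<le> B"
    using bounded_continuous_K[OF continuous_gen_poly] by blast
  define e where "e = \<delta> / (2 * B)"
  have e: "e > 0" "e * B < \<delta>" using \<delta> B by (auto simp: e_def)
  have "s - e *\<^sub>R c \<in> pos_cone K \<alpha>"
    unfolding pos_cone_def
  proof safe
    fix x assume x: "x \<in> K"
    have "e * gen_poly \<alpha> c x \<le> e * B"
      using B(2)[OF x] e by (intro mult_left_mono) auto
    then show "gen_poly \<alpha> (s - e *\<^sub>R c) x > 0" using \<delta>(2)[OF x] e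
      by (simp only: gen_poly_linear)
  qed
  then have "e * (c \<bullet> c) \<le> c \<bullet> s"
    using nonneg by (fastforce simp: inner_diff_right)
  moreover have "e * (c \<bullet> c) > 0" using e \<open>c \<noteq> 0\<close> by simp
  ultimately show ?thesis by linarith
qed

text \<open>
  Rescaling the curve to \<open>\<langle>s, v\<rangle> = 1\<close> for some \<open>s\<close> in the positive cone makes the conic hull
  a cone over a compact convex base, so that a point can be separated from the base strictly.
\<close>

lemma conic_hull_representation:
  assumes nonneg: "\<And>r. r \<in> pos_cone K \<alpha> \<Longrightarrow> c \<bullet> r \<ge> 0"
  obtains S w where "finite S" "S \<subseteq> K" "\<And>x. x \<in> S \<Longrightarrow> w x \<ge> 0"
    "c = (\<Sum>x\<in>S. w x *\<^sub>R moment_curve \<alpha> x)"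
proof (cases "c = 0")
  case True
  then show ?thesis using that[of "{}" "\<lambda>_. 0"] by simp
next
  case False
  obtain s where s: "s \<in> pos_cone K \<alpha>" using pos_cone_nonempty by blast
  then have s_pos: "\<And>x. x \<in> K \<Longrightarrow> gen_poly \<alpha> s x > 0" by (auto simp: pos_cone_def)
  have cs: "c \<bullet> s > 0" using pos_cone_inner_pos[OF nonneg False s] by blast
  define b where "b x = inverse (gen_poly \<alpha> s x) *\<^sub>R moment_curve \<alpha> x" for x
  have "continuous_on K b"
    unfolding b_def using s_pos
    by (intro continuous_intros continuous_gen_poly continuous_moment_curve) force
  then have comp: "compact (convex hull (b ` K))"
    by (intro compact_convex_hull compact_continuous_image compact_K)
  have "inverse (c \<bullet> s) *\<^sub>R c \<in> convex hull (b ` K)"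
  proof (rule ccontr)
    assume "inverse (c \<bullet> s) *\<^sub>R c \<notin> convex hull (b ` K)"
    then obtain a \<beta> where a: "a \<bullet> (inverse (c \<bullet> s) *\<^sub>R c) < \<beta>"
        "\<And>v. v \<in> convex hull (b ` K) \<Longrightarrow> a \<bullet> v > \<beta>"
      using separating_hyperplane_closed_point[OF convex_convex_hull compact_imp_closed[OF comp]] by blast
    \<comment> \<open>The base lies in the hyperplane where the pairing with \<open>s\<close> is 1,
      so \<open>\<beta>\<close> equals the pairing of \<open>\<beta> *\<^sub>R s\<close> with each
      point of it. Separation thus becomes positivity of one polynomial on \<open>K\<close>.\<close>
    have "a - \<beta> *\<^sub>R s \<in> pos_cone K \<alpha>"
      unfolding pos_cone_def
    proof safe
      fix x assume x: "x \<in> K"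
      then have "b x \<in> convex hull (b ` K)" by (intro hull_inc) auto
      from a(2)[OF this] have "\<beta> < inverse (gen_poly \<alpha> s x) * gen_poly \<alpha> a x"
        by (simp add: b_def gen_poly_inner)
      then show "gen_poly \<alpha> (a - \<beta> *\<^sub>R s) x > 0"
        using s_pos[OF x] by (simp add: field_simps)
    qed
    then have "c \<bullet> a \<ge> \<beta> * (c \<bullet> s)" using nonneg by (fastforce simp: inner_diff_right)
    moreover have "c \<bullet> a < \<beta> * (c \<bullet> s)"
      using a(1) cs by (simp add: field_simps inner_commute)
    ultimately show False by linarith
  qed
  then obtain V u where V: "finite V" "V \<subseteq> b ` K" "\<And>v. v \<in> V \<Longrightarrow> u v \<ge> 0"
      "(\<Sum>v\<in>V. u v *\<^sub>R v) = inverse (c \<bullet> s) *\<^sub>R c"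
    unfolding convex_hull_explicit by auto
  \<comment> \<open>One preimage in \<open>K\<close> is chosen for each point of \<open>V\<close>;
    injectivity allows reindexing the sum.\<close>
  obtain S where S: "S \<subseteq> K" "inj_on b S" "V = b ` S"
    using V(2) by (auto simp: subset_image_inj)
  show ?thesis
  proof (rule that)
    show "finite S" using V(1) S by (metis finite_image_iff)
    show "S \<subseteq> K" by fact
    \<comment> \<open>The weights undo both normalizations, that of \<open>c\<close> and that of the
      curve.\<close>
    show "(c \<bullet> s) * u (b x) * inverse (gen_poly \<alpha> s x) \<ge> 0" if "x \<in> S" for x
      using that S V(3)[of "b x"] cs s_pos[of x] by (auto intro!: mult_nonneg_nonneg simp: less_imp_le)
    have "c = (c \<bullet> s) *\<^sub>R (\<Sum>v\<in>V. u v *\<^sub>R v)" using cs V(4) by simp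
    also have "\<dots> = (\<Sum>x\<in>S. ((c \<bullet> s) * u (b x) * inverse (gen_poly \<alpha> s x)) *\<^sub>R moment_curve \<alpha> x)"
      unfolding S(3) sum.reindex[OF S(2)] scaleR_sum_right
      by (intro sum.cong refl) (simp add: b_def)
    finally show "c = (\<Sum>x\<in>S. ((c \<bullet> s) * u (b x) * inverse (gen_poly \<alpha> s x)) *\<^sub>R moment_curve \<alpha> x)" .
  qed
qed

text \<open>Pairing the conic combination with \<open>q\<close> gives a zero sum of nonnegative
  terms \<open>w x * Q x\<close>, so all weight sits at zeros of \<open>Q\<close>. A measure carried
  by a finite set is singular.\<close>

lemma singular_representation:
  assumes nonneg: "\<And>r. r \<in> pos_cone K \<alpha> \<Longrightarrow> c \<bullet> r \<ge> 0"
    and q: "q \<in> closure (pos_cone K \<alpha>)" and cq: "c \<bullet> q = 0"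
  shows "\<exists>\<mu>. sets \<mu> = sets (restrict_space borel K) \<and> finite_measure \<mu> \<and>
          mutually_singular \<mu> (leb_on K) \<and>
          measure_supp \<mu> \<subseteq> {x\<in>K. gen_poly \<alpha> q x = 0} \<and>
          (\<forall>k. c $ k = (\<integral>x. \<alpha> k x \<partial>\<mu>))"
proof -
  obtain S w where S: "finite S" "S \<subseteq> K" "\<And>x. x \<in> S \<Longrightarrow> w x \<ge> 0"
    and c: "c = (\<Sum>x\<in>S. w x *\<^sub>R moment_curve \<alpha> x)"
    using conic_hull_representation[OF nonneg] by blast
  have "(\<Sum>x\<in>S. w x * gen_poly \<alpha> q x) = c \<bullet> q"
    by (simp add: c inner_sum_left gen_poly_inner inner_commute[of q])
  then have wq: "w x * gen_poly \<alpha> q x = 0" if "x \<in> S" for x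
  proof -
    have "\<And>y. y \<in> S \<Longrightarrow> w y * gen_poly \<alpha> q y \<ge> 0"
      using S q by (auto simp: closure_pos_cone intro!: mult_nonneg_nonneg)
    from sum_nonneg_eq_0_iff[OF S(1) this] show ?thesis
      using that cq \<open>(\<Sum>x\<in>S. w x * gen_poly \<alpha> q x) = c \<bullet> q\<close> by simp
  qed
  let ?B = "restrict_space borel K"
  have space_B [simp]: "space ?B = K" by (simp add: space_restrict_space)
  \<comment> \<open>A point measure lives on all subsets of \<open>S\<close>; its image under the
    identity is a measure on the Borel sets of \<open>K\<close>.\<close>
  define \<mu> where "\<mu> = distr (point_measure S (\<lambda>x. ennreal (w x))) ?B (\<lambda>x. x)"
  have meas: "(\<lambda>x. x) \<in> point_measure S (\<lambda>x. ennreal (w x)) \<rightarrow>\<^sub>M ?B"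
    using S by auto
  have sets_\<mu> [simp]: "sets \<mu> = sets ?B" and space_\<mu> [simp]: "space \<mu> = K"
    by (simp_all add: \<mu>_def)
  have em: "emeasure \<mu> A = (\<Sum>x\<in>A \<inter> S. ennreal (w x))" if "A \<in> sets ?B" for A
    unfolding \<mu>_def using that S
    by (subst emeasure_distr[OF meas]) (auto simp: space_point_measure emeasure_point_measure_finite)
  have "finite_measure \<mu>"
  proof (rule finite_measureI)
    have "emeasure \<mu> K = ennreal (\<Sum>x\<in>K \<inter> S. w x)"
      using em[of K] sets.top[of ?B] S by (subst sum_ennreal[symmetric]) auto
    then show "emeasure \<mu> (space \<mu>) \<noteq> \<infinity>" by simp
  qed
  moreover have "mutually_singular \<mu> (leb_on K)"
    unfolding mutually_singular_def
  proof (intro conjI bexI[of _ S])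
    show "sets \<mu> = sets (leb_on K)"
      unfolding sets_\<mu> by (rule sets_restrict_space_cong) simp
    have "S \<in> sets borel" using S by (simp add: borel_closed finite_imp_closed)
    then show S_sets: "S \<in> sets \<mu>" using S by (auto simp: sets_restrict_space)
    then have "K - S \<in> sets ?B" using sets.compl_sets[of S ?B] by simp
    then show "emeasure \<mu> (space \<mu> - S) = 0"
      using em[of "K - S"] by (auto intro: sum.neutral)
    show "emeasure (leb_on K) S = 0"
      using S by (subst emeasure_restrict_space) (auto simp: emeasure_lborel_countable countable_finite)
  qed
  moreover have "measure_supp \<mu> \<subseteq> {x\<in>K. gen_poly \<alpha> q x = 0}"
  proof (intro subsetI CollectI conjI)
    fix x assume x: "x \<in> measure_supp \<mu>"
    then show "x \<in> K" by (simp add: measure_supp_def)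
    show "gen_poly \<alpha> q x = 0"
    proof (rule ccontr)
      assume nz: "gen_poly \<alpha> q x \<noteq> 0"
      \<comment> \<open>\<open>S\<close> may contain points off the zero set, but their weights
        vanish. Hence the relatively open set where \<open>Q\<close> is nonzero has measure zero and
        cannot meet the support.\<close>
      obtain U where U: "open U" "U \<inter> K = gen_poly \<alpha> q -` (- {0}) \<inter> K"
        using continuous_on_open_invariant[of K "gen_poly \<alpha> q"] continuous_gen_poly
        by (metis open_Compl closed_singleton)
      have "x \<in> U" using U nz \<open>x \<in> K\<close> by auto
      with x U have "emeasure \<mu> (U \<inter> K) > 0" by (auto simp: measure_supp_def)
      moreover have "U \<inter> K \<in> sets ?B"
        using borel_open[OF U(1)] unfolding sets_restrict_space Int_commute[of U] by (rule imageI)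
      moreover have "w y = 0" if "y \<in> U \<inter> K \<inter> S" for y
        using that U wq[of y] by auto
      ultimately show False using em[of "U \<inter> K"] by simp
    qed
  qed
  moreover have "c $ k = (\<integral>x. \<alpha> k x \<partial>\<mu>)" for k
  proof -
    have "(\<integral>x. \<alpha> k x \<partial>\<mu>) = (\<integral>x. \<alpha> k x \<partial>point_measure S (\<lambda>x. ennreal (w x)))"
      unfolding \<mu>_def
      by (rule integral_distr[OF meas borel_measurable_continuous_on_restrict[OF continuous_\<alpha>]])
    also have "\<dots> = (\<Sum>x\<in>S. w x * \<alpha> k x)"
      using S by (simp add: lebesgue_integral_point_measure_finite)
    finally show ?thesis by (simp add: c moment_curve_def)
  qed
  ultimately show ?thesis using sets_\<mu> by blast
qed

section \<open>Maximizing the logarithmic integral on a slice\<close>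

lemma closure_pos_cone_scaleR:
  "q \<in> closure (pos_cone K \<alpha>) \<Longrightarrow> t \<ge> 0 \<Longrightarrow> t *\<^sub>R q \<in> closure (pos_cone K \<alpha>)"
  by (simp add: closure_pos_cone)

text \<open>On the unit vectors of the closed cone, a compact set, \<open>c\<close> attains a
  positive minimum; homogeneity extends the bound.\<close>

lemma dual_cone_coercive:
  assumes c: "c \<in> dual_cone K \<alpha>"
  obtains \<delta> where "\<delta> > 0" "\<And>q. q \<in> closure (pos_cone K \<alpha>) \<Longrightarrow> \<delta> * norm q \<le> c \<bullet> q"
proof -
  let ?D = "closure (pos_cone K \<alpha>) \<inter> sphere 0 1"
  obtain \<delta> where \<delta>: "\<delta> > 0" "\<And>y. y \<in> ?D \<Longrightarrow> \<delta> \<le> c \<bullet> y"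
  proof (cases "?D = {}")
    case False
    have comp: "compact ?D" by (intro closed_Int_compact) auto
    have cont: "continuous_on ?D (\<lambda>y. c \<bullet> y)" by (intro continuous_intros)
    obtain y where "y \<in> ?D" "\<And>z. z \<in> ?D \<Longrightarrow> c \<bullet> y \<le> c \<bullet> z"
      using continuous_attains_inf[OF comp False cont] by blast
    moreover from this have "y \<noteq> 0" by auto
    ultimately show ?thesis using that[of "c \<bullet> y"] c by (auto simp: dual_cone_def)
  qed (use that[of 1] in auto)
  show thesis
  proof (rule that[OF \<delta>(1)])
    fix q assume q: "q \<in> closure (pos_cone K \<alpha>)"
    show "\<delta> * norm q \<le> c \<bullet> q"
    proof (cases "q = 0")
      case False
      then have "inverse (norm q) *\<^sub>R q \<in> ?D"
        using q by (auto intro!: closure_pos_cone_scaleR)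
      from \<delta>(2)[OF this] show ?thesis using False by (simp add: field_simps)
    qed simp
  qed
qed

definition slice :: "real^'n \<Rightarrow> real \<Rightarrow> (real^'n) set" where
  "slice c m = {q \<in> closure (pos_cone K \<alpha>). c \<bullet> q = m}"

text \<open>Coercivity bounds the norm on the slice by \<open>m / \<delta>\<close>, and the slice is
  closed.\<close>

lemma compact_slice:
  assumes c: "c \<in> dual_cone K \<alpha>"
  shows "compact (slice c m)"
proof -
  obtain \<delta> where \<delta>: "\<delta> > 0" "\<And>q. q \<in> closure (pos_cone K \<alpha>) \<Longrightarrow> \<delta> * norm q \<le> c \<bullet> q"
    using dual_cone_coercive[OF c] by blast
  have "slice c m = closure (pos_cone K \<alpha>) \<inter> {q. c \<bullet> q = m}" by (auto simp: slice_def)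
  then have "closed (slice c m)" by (simp add: closed_Int closed_hyperplane)
  moreover have "slice c m \<subseteq> cball 0 (m / \<delta>)"
    using \<delta> by (auto simp: slice_def field_simps)
  ultimately show ?thesis
    using bounded_cball bounded_subset compact_eq_bounded_closed by blast
qed

text \<open>
  The maximizer of \<open>\<integral> P log Q\<close> on a slice exists by Fatou's lemma: with \<open>M\<close> an upper bound of \<open>Q\<close>
  over the slice, the integrands \<open>P (M - log Q)\<close> are nonnegative.
\<close>

lemma slice_maximizer:
  assumes c: "c \<in> dual_cone K \<alpha>" and p: "p \<in> closure (pos_cone K \<alpha>)"
    and "m > 0" and s: "s \<in> slice c m \<inter> pos_cone K \<alpha>"
  obtains q where "q \<in> slice c m" "integrable (leb_on K) (\<lambda>x. gen_poly \<alpha> p x * ln (gen_poly \<alpha> q x))"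
    "\<forall>r\<in>slice c m. integrable (leb_on K) (\<lambda>x. gen_poly \<alpha> p x * ln (gen_poly \<alpha> r x)) \<longrightarrow>
      (\<integral>x. gen_poly \<alpha> p x * ln (gen_poly \<alpha> r x) \<partial>leb_on K)
        \<le> (\<integral>x. gen_poly \<alpha> p x * ln (gen_poly \<alpha> q x) \<partial>leb_on K)"
proof -
  have P_nonneg: "gen_poly \<alpha> p x \<ge> 0" if "x \<in> K" for x
    using p that by (simp add: closure_pos_cone)
  obtain B where B: "\<And>q. q \<in> slice c m \<Longrightarrow> norm q \<le> B"
    using compact_imp_bounded[OF compact_slice[OF c], of m] unfolding bounded_iff by blast
  obtain A where A: "A > 0" "\<And>x. x \<in> K \<Longrightarrow> norm (moment_curve \<alpha> x) \<le> A"
    using compact_imp_bounded[OF compact_continuous_image[OF continuous_moment_curve compact_K]]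
    by (auto simp: bounded_pos)
  \<comment> \<open>The absolute value ensures \<open>M \<ge> 0\<close>, which covers the points
    with \<open>Q = 0\<close>, where \<open>ln 0 = 0\<close>.\<close>
  define M where "M = \<bar>B\<bar> * A"
  have M: "ln (gen_poly \<alpha> q x) \<le> M" if "q \<in> slice c m" "x \<in> K" for q x
  proof (cases "gen_poly \<alpha> q x = 0")
    case False
    then have "gen_poly \<alpha> q x > 0"
      using that by (simp add: slice_def closure_pos_cone order.strict_iff_order)
    then have "ln (gen_poly \<alpha> q x) \<le> gen_poly \<alpha> q x"
      using ln_le_minus_one by fastforce
    also have "\<dots> \<le> norm q * norm (moment_curve \<alpha> x)"
      by (simp add: gen_poly_inner norm_cauchy_schwarz)
    also have "\<dots> \<le> \<bar>B\<bar> * A"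
      using B[OF that(1)] A(2)[OF that(2)] by (intro mult_mono) auto
    finally show ?thesis by (simp add: M_def)
  qed (use A in \<open>simp add: M_def\<close>)
  define g where "g q x = gen_poly \<alpha> p x * (M - ln (gen_poly \<alpha> q x))" for q x
  have g_meas [measurable]: "g q \<in> borel_measurable (leb_on K)" for q
    unfolding g_def by measurable
  have g_nonneg: "g q x \<ge> 0" if "q \<in> slice c m" "x \<in> K" for q x
    unfolding g_def using M[OF that] P_nonneg[OF that(2)] by (intro mult_nonneg_nonneg) auto
  have int_PM: "integrable (leb_on K) (\<lambda>x. gen_poly \<alpha> p x * M)"
    by (intro integrable_continuous_K continuous_intros continuous_gen_poly)
  have g_int: "integrable (leb_on K) (g q) \<longleftrightarrow>
      integrable (leb_on K) (\<lambda>x. gen_poly \<alpha> p x * ln (gen_poly \<alpha> q x))" for q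
  proof
    assume "integrable (leb_on K) (g q)"
    from Bochner_Integration.integrable_diff[OF int_PM this]
    show "integrable (leb_on K) (\<lambda>x. gen_poly \<alpha> p x * ln (gen_poly \<alpha> q x))"
      by (simp add: g_def algebra_simps)
  next
    assume "integrable (leb_on K) (\<lambda>x. gen_poly \<alpha> p x * ln (gen_poly \<alpha> q x))"
    from Bochner_Integration.integrable_diff[OF int_PM this]
    show "integrable (leb_on K) (g q)"
      by (simp add: g_def[abs_def] algebra_simps)
  qed
  \<comment> \<open>The extended integral is defined on the whole slice, so the infimum may range
    over vectors with a divergent integral too.\<close>
  define I where "I q = (\<integral>\<^sup>+x. ennreal (g q x) \<partial>leb_on K)" for q
  have I_eq: "I q = ennreal (\<integral>x. g q x \<partial>leb_on K)" if "q \<in> slice c m" "integrable (leb_on K) (g q)" for q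
    unfolding I_def using that g_nonneg by (intro nn_integral_eq_integral AE_I2) auto
  obtain f :: "nat \<Rightarrow> ennreal" where f: "decseq f" "range f \<subseteq> I ` slice c m" "Inf (I ` slice c m) = (INF i. f i)"
    using ennreal_Inf_countable_INF[of "I ` slice c m"] s by auto
  then have "\<forall>n. \<exists>q. q \<in> slice c m \<and> I q = f n"
    by (simp add: image_subset_iff image_iff) metis
  then obtain u where u: "\<And>n. u n \<in> slice c m" "\<And>n. I (u n) = f n" by metis
  obtain q \<rho> where q: "q \<in> slice c m" and \<rho>: "strict_mono (\<rho> :: nat \<Rightarrow> nat)" and lim: "(u \<circ> \<rho>) \<longlonglongrightarrow> q"
    using seq_compactE[OF compact_imp_seq_compact[OF compact_slice[OF c]], of u] u(1) by metis
  have I_min: "I q \<le> I r" if "r \<in> slice c m" for r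
  proof -
    \<comment> \<open>Coefficients converge, hence so do the values at \<open>x\<close>; continuity
      of \<open>ln\<close> needs the limit value to be positive, which holds almost
      everywhere.\<close>
    have pt: "ennreal (g q x) \<le> liminf (\<lambda>n. ennreal (g (u (\<rho> n)) x))" if "gen_poly \<alpha> q x > 0" for x
    proof -
      have "(\<lambda>n. gen_poly \<alpha> (u (\<rho> n)) x) \<longlonglongrightarrow> gen_poly \<alpha> q x"
        unfolding gen_poly_inner using lim by (intro tendsto_intros) (simp add: o_def)
      then have "(\<lambda>n. ennreal (g (u (\<rho> n)) x)) \<longlonglongrightarrow> ennreal (g q x)"
        unfolding g_def using that by (intro tendsto_intros) auto
      from lim_imp_Liminf[OF _ this] show ?thesis by simp
    qed
    have "q \<in> closure (pos_cone K \<alpha>) - {0}"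
      using q \<open>m > 0\<close> by (auto simp: slice_def)
    from AE_gen_poly_pos[OF this]
    have "I q \<le> (\<integral>\<^sup>+x. liminf (\<lambda>n. ennreal (g (u (\<rho> n)) x)) \<partial>leb_on K)"
      unfolding I_def by (intro nn_integral_mono_AE) (auto elim!: eventually_mono intro: pt)
    also have "\<dots> \<le> liminf (\<lambda>n. I (u (\<rho> n)))"
      unfolding I_def by (intro nn_integral_liminf) simp
    also have "\<dots> = Inf (I ` slice c m)"
      using LIMSEQ_subseq_LIMSEQ[OF LIMSEQ_INF[OF f(1)] \<rho>]
      by (intro lim_imp_Liminf) (auto simp: u(2) f(3) o_def)
    also have "\<dots> \<le> I r" using that by (rule INF_lower)
    finally show ?thesis .
  qed
  \<comment> \<open>The strictly positive \<open>s\<close> has a finite integral, so the infimum,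
    and with it the value at \<open>q\<close>, is finite.\<close>
  have "continuous_on K (\<lambda>x. gen_poly \<alpha> p x * ln (gen_poly \<alpha> s x))"
    using s by (intro continuous_intros continuous_gen_poly) (auto simp: pos_cone_def)
  then have "integrable (leb_on K) (g s)"
    unfolding g_int by (rule integrable_continuous_K)
  then have "I q < \<infinity>"
    using I_min[of s] I_eq[of s] s by (auto simp: le_less_trans)
  then have int_q: "integrable (leb_on K) (g q)"
    using g_nonneg[OF q] unfolding I_def by (intro integrableI_nonneg) auto
  show thesis
  proof (rule that[OF q])
    show "integrable (leb_on K) (\<lambda>x. gen_poly \<alpha> p x * ln (gen_poly \<alpha> q x))"
      using int_q by (simp only: g_int)
  next
    show "\<forall>r\<in>slice c m. integrable (leb_on K) (\<lambda>x. gen_poly \<alpha> p x * ln (gen_poly \<alpha> r x)) \<longrightarrow>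
      (\<integral>x. gen_poly \<alpha> p x * ln (gen_poly \<alpha> r x) \<partial>leb_on K)
        \<le> (\<integral>x. gen_poly \<alpha> p x * ln (gen_poly \<alpha> q x) \<partial>leb_on K)"
    proof (intro ballI impI)
      fix r assume r: "r \<in> slice c m"
        and int: "integrable (leb_on K) (\<lambda>x. gen_poly \<alpha> p x * ln (gen_poly \<alpha> r x))"
      have eq: "(\<integral>x. g t x \<partial>leb_on K) = (\<integral>x. gen_poly \<alpha> p x * M \<partial>leb_on K)
          - (\<integral>x. gen_poly \<alpha> p x * ln (gen_poly \<alpha> t x) \<partial>leb_on K)"
        if "integrable (leb_on K) (\<lambda>x. gen_poly \<alpha> p x * ln (gen_poly \<alpha> t x))" for t
        unfolding g_def right_diff_distrib
        by (rule Bochner_Integration.integral_diff[OF int_PM that])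
      have "ennreal (\<integral>x. g q x \<partial>leb_on K) \<le> ennreal (\<integral>x. g r x \<partial>leb_on K)"
        using I_min[OF r] I_eq[OF q int_q] I_eq[OF r] int by (simp add: g_int)
      moreover have "(\<integral>x. g r x \<partial>leb_on K) \<ge> 0"
        using g_nonneg[OF r] by (intro integral_nonneg_AE AE_I2) auto
      ultimately have "(\<integral>x. g q x \<partial>leb_on K) \<le> (\<integral>x. g r x \<partial>leb_on K)"
        by (simp add: ennreal_le_iff)
      then show "(\<integral>x. gen_poly \<alpha> p x * ln (gen_poly \<alpha> r x) \<partial>leb_on K)
          \<le> (\<integral>x. gen_poly \<alpha> p x * ln (gen_poly \<alpha> q x) \<partial>leb_on K)"
      using eq[OF int] eq[OF int_q[unfolded g_int]] by linarith
    qed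
  qed
qed

text \<open>
  First-order condition at the maximizer, along \<open>Q\<^sub>t = (1 - t) Q + t R\<close>. Comparing with the tangent
  of \<open>ln\<close> at \<open>Q\<^sub>t\<close>, which is bounded away from zero, gives \<open>\<integral> P R/Q\<^sub>t \<le> \<integral> P Q/Q\<^sub>t \<le> (\<integral> P)/(1 - t)\<close>
  before the limit \<open>t \<rightarrow> 0\<close>.
\<close>

lemma slice_maximizer_variation:
  assumes p: "p \<in> closure (pos_cone K \<alpha>)" and "m > 0" and q: "q \<in> slice c m"
    and int_q: "integrable (leb_on K) (\<lambda>x. gen_poly \<alpha> p x * ln (gen_poly \<alpha> q x))"
    and max: "\<forall>r\<in>slice c m. integrable (leb_on K) (\<lambda>x. gen_poly \<alpha> p x * ln (gen_poly \<alpha> r x)) \<longrightarrow>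
      (\<integral>x. gen_poly \<alpha> p x * ln (gen_poly \<alpha> r x) \<partial>leb_on K)
        \<le> (\<integral>x. gen_poly \<alpha> p x * ln (gen_poly \<alpha> q x) \<partial>leb_on K)"
    and r: "r \<in> slice c m \<inter> pos_cone K \<alpha>"
  shows "integrable (leb_on K) (\<lambda>x. gen_poly \<alpha> r x * (gen_poly \<alpha> p x / gen_poly \<alpha> q x))"
    and "(\<integral>x. gen_poly \<alpha> r x * (gen_poly \<alpha> p x / gen_poly \<alpha> q x) \<partial>leb_on K)
      \<le> (\<integral>x. gen_poly \<alpha> p x \<partial>leb_on K)"
proof -
  define P Q R where "P = gen_poly \<alpha> p" and "Q = gen_poly \<alpha> q" and "R = gen_poly \<alpha> r"
  have cont [continuous_intros]: "continuous_on K P" "continuous_on K Q" "continuous_on K R"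
    by (simp_all add: P_def Q_def R_def continuous_gen_poly)
  have [measurable]: "P \<in> borel_measurable (leb_on K)" "Q \<in> borel_measurable (leb_on K)"
    "R \<in> borel_measurable (leb_on K)"
    by (simp_all add: P_def Q_def R_def)
  have P: "P x \<ge> 0" and Q: "Q x \<ge> 0" and R: "R x > 0" if "x \<in> K" for x
    using that p q r unfolding slice_def closure_pos_cone
    by (auto simp: P_def Q_def R_def pos_cone_def)
  have posQ: "AE x in leb_on K. Q x > 0"
    unfolding Q_def using q \<open>m > 0\<close> by (intro AE_gen_poly_pos) (auto simp: slice_def)
  have int_P: "integrable (leb_on K) P" by (intro integrable_continuous_K cont)
  have P_int: "(\<integral>x. P x \<partial>leb_on K) \<ge> 0" using P by (intro integral_nonneg_AE AE_I2) auto
  define Qt where "Qt t x = (1 - t) * Q x + t * R x" for t x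
  have le: "(\<integral>\<^sup>+x. ennreal (R x * (P x / Qt t x)) \<partial>leb_on K)
      \<le> ennreal ((\<integral>x. P x \<partial>leb_on K) / (1 - t))" if t: "0 < t" "t < 1" for t
  proof -
    have Qt: "Qt t x > 0" "Qt t x \<ge> (1 - t) * Q x" if "x \<in> K" for x
      using t Q[OF that] R[OF that] by (auto simp: Qt_def intro!: add_nonneg_pos)
    have Qt_eq: "Qt t = gen_poly \<alpha> ((1 - t) *\<^sub>R q + t *\<^sub>R r)"
      by (auto simp: Qt_def Q_def R_def)
    have cont_Qt [continuous_intros]: "continuous_on K (Qt t)"
      unfolding Qt_eq by (rule continuous_gen_poly)
    have nz: "\<forall>x\<in>K. Qt t x \<noteq> 0" "\<forall>x\<in>K. Qt t x > 0" using Qt(1) by force+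
    have slice: "(1 - t) *\<^sub>R q + t *\<^sub>R r \<in> slice c m"
    proof -
      have "(1 - t) * m + t * m = m" by (simp add: algebra_simps)
      then show ?thesis
        using q r t unfolding slice_def closure_pos_cone
        by (auto simp: inner_add_right intro!: add_nonneg_nonneg mult_nonneg_nonneg)
    qed
    have int_ln: "integrable (leb_on K) (\<lambda>x. P x * ln (Qt t x))"
      by (intro integrable_continuous_K continuous_intros nz)
    have int_R: "integrable (leb_on K) (\<lambda>x. R x * (P x / Qt t x))"
      and int_Q: "integrable (leb_on K) (\<lambda>x. Q x * (P x / Qt t x))"
      by (intro integrable_continuous_K continuous_intros nz)+
    have "(\<integral>x. t * (R x * (P x / Qt t x) - Q x * (P x / Qt t x)) \<partial>leb_on K)
        \<le> (\<integral>x. P x * ln (Qt t x) - P x * ln (Q x) \<partial>leb_on K)"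
    proof (rule integral_mono_AE)
      show "AE x in leb_on K. t * (R x * (P x / Qt t x) - Q x * (P x / Qt t x))
          \<le> P x * ln (Qt t x) - P x * ln (Q x)"
        using posQ AE_space
      proof eventually_elim
        case (elim x)
        \<comment> \<open>Tangent at \<open>Qt\<close>, using
          \<open>Q - Qt = - t * (R - Q)\<close>.\<close>
        then have "ln (Q x) - ln (Qt t x) \<le> (Q x - Qt t x) / Qt t x"
          using Qt(1)[of x] by (intro ln_diff_le) auto
        moreover have "(Q x - Qt t x) / Qt t x = - (t * (R x - Q x) / Qt t x)"
          by (simp add: Qt_def algebra_simps minus_divide_left)
        ultimately have "P x * (t * (R x - Q x) / Qt t x) \<le> P x * (ln (Qt t x) - ln (Q x))"
          using P[of x] elim by (intro mult_left_mono) auto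
        then show ?case by (simp add: algebra_simps diff_divide_distrib)
      qed
    qed (use int_ln int_R int_Q int_q in \<open>auto simp: P_def Q_def\<close>)
    also have "\<dots> = (\<integral>x. P x * ln (Qt t x) \<partial>leb_on K) - (\<integral>x. P x * ln (Q x) \<partial>leb_on K)"
      using int_ln int_q by (intro Bochner_Integration.integral_diff) (auto simp: P_def Q_def)
    also have "\<dots> \<le> 0"
      using bspec[OF max slice] int_ln by (simp add: Qt_eq P_def Q_def)
    finally have "t * ((\<integral>x. R x * (P x / Qt t x) \<partial>leb_on K) - (\<integral>x. Q x * (P x / Qt t x) \<partial>leb_on K)) \<le> 0"
      using int_R int_Q by simp
    then have "(\<integral>x. R x * (P x / Qt t x) \<partial>leb_on K) \<le> (\<integral>x. Q x * (P x / Qt t x) \<partial>leb_on K)"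
      using t by (simp add: mult_le_0_iff)
    \<comment> \<open>Since \<open>R > 0\<close>, \<open>Qt\<close> dominates
      \<open>(1 - t) * Q\<close>.\<close>
    also have "\<dots> \<le> (\<integral>x. P x / (1 - t) \<partial>leb_on K)"
    proof (rule integral_mono_AE[OF int_Q])
      show "AE x in leb_on K. Q x * (P x / Qt t x) \<le> P x / (1 - t)"
      proof (rule AE_I2)
        fix x assume "x \<in> space (leb_on K)"
        then have x: "x \<in> K" by simp
        have "P x * ((1 - t) * Q x) \<le> P x * Qt t x"
          using P[OF x] Qt(2)[OF x] by (intro mult_left_mono)
        then show "Q x * (P x / Qt t x) \<le> P x / (1 - t)"
          using Qt(1)[OF x] t by (simp add: field_simps)
      qed
    qed (use int_P in simp)
    finally have "(\<integral>x. R x * (P x / Qt t x) \<partial>leb_on K) \<le> (\<integral>x. P x \<partial>leb_on K) / (1 - t)"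
      by simp
    moreover have "(\<integral>\<^sup>+x. ennreal (R x * (P x / Qt t x)) \<partial>leb_on K) = ennreal (\<integral>x. R x * (P x / Qt t x) \<partial>leb_on K)"
      using P R Qt(1) by (intro nn_integral_eq_integral int_R AE_I2) (auto simp: less_imp_le)
    ultimately show ?thesis by (simp add: ennreal_leI)
  qed
  \<comment> \<open>The shift by two keeps \<open>T 0 = 1/2\<close> below 1.\<close>
  define T where "T n = inverse (real (Suc (Suc n)))" for n
  have T: "0 < T n" "T n < 1" for n by (auto simp: T_def field_simps)
  have T_lim: "T \<longlonglongrightarrow> 0"
    unfolding T_def using LIMSEQ_inverse_real_of_nat by (rule LIMSEQ_Suc)
  have pt: "ennreal (R x * (P x / Q x)) \<le> liminf (\<lambda>n. ennreal (R x * (P x / Qt (T n) x)))"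
    if "Q x > 0" for x
  proof -
    have "(\<lambda>n. Qt (T n) x) \<longlonglongrightarrow> (1 - 0) * Q x + 0 * R x"
      unfolding Qt_def by (intro tendsto_intros T_lim)
    then have "(\<lambda>n. ennreal (R x * (P x / Qt (T n) x))) \<longlonglongrightarrow> ennreal (R x * (P x / Q x))"
      using that by (intro tendsto_intros) auto
    from lim_imp_Liminf[OF _ this] show ?thesis by simp
  qed
  have "(\<integral>\<^sup>+x. ennreal (R x * (P x / Q x)) \<partial>leb_on K)
      \<le> (\<integral>\<^sup>+x. liminf (\<lambda>n. ennreal (R x * (P x / Qt (T n) x))) \<partial>leb_on K)"
    by (intro nn_integral_mono_AE eventually_mono[OF posQ] pt)
  also have "\<dots> \<le> liminf (\<lambda>n. \<integral>\<^sup>+x. ennreal (R x * (P x / Qt (T n) x)) \<partial>leb_on K)"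
    by (intro nn_integral_liminf) (simp add: Qt_def)
  also have "\<dots> \<le> liminf (\<lambda>n. ennreal ((\<integral>x. P x \<partial>leb_on K) / (1 - T n)))"
    using le[OF T] by (intro Liminf_mono) auto
  also have "\<dots> = ennreal ((\<integral>x. P x \<partial>leb_on K) / (1 - 0))"
    by (intro lim_imp_Liminf tendsto_intros T_lim) auto
  finally have fatou: "(\<integral>\<^sup>+x. ennreal (R x * (P x / Q x)) \<partial>leb_on K) \<le> ennreal (\<integral>x. P x \<partial>leb_on K)"
    by simp
  have nonneg: "AE x in leb_on K. 0 \<le> R x * (P x / Q x)"
    using P Q R by (intro AE_I2) (auto simp: less_imp_le)
  have int: "integrable (leb_on K) (\<lambda>x. R x * (P x / Q x))"
    using fatou nonneg by (intro integrableI_nonneg) (auto simp: le_less_trans)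
  then show "integrable (leb_on K) (\<lambda>x. gen_poly \<alpha> r x * (gen_poly \<alpha> p x / gen_poly \<alpha> q x))"
    by (simp add: P_def Q_def R_def)
  have "(\<integral>x. R x * (P x / Q x) \<partial>leb_on K) \<le> (\<integral>x. P x \<partial>leb_on K)"
    using fatou P_int nn_integral_eq_integral[OF int nonneg] by (simp add: ennreal_le_iff)
  then show "(\<integral>x. gen_poly \<alpha> r x * (gen_poly \<alpha> p x / gen_poly \<alpha> q x) \<partial>leb_on K)
      \<le> (\<integral>x. gen_poly \<alpha> p x \<partial>leb_on K)"
    by (simp add: P_def Q_def R_def)
qed

section \<open>Existence of a solution\<close>

lemma moment_solution_exists:
  assumes c: "c \<in> dual_cone K \<alpha>" and p: "p \<in> closure (pos_cone K \<alpha>) - {0}"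
  obtains c' q where "moment_solution K \<alpha> c p c' q"
proof -
  \<comment> \<open>Along a ray \<open>t *\<^sub>R q\<close> the functional is
    \<open>t * (c \<bullet> q) - m * ln t\<close> up to a constant, least where the pairing of
    \<open>c\<close> with the point equals \<open>m\<close>. This selects the slice.\<close>
  define m where "m = (\<integral>x. gen_poly \<alpha> p x \<partial>leb_on K)"
  have int_P: "integrable (leb_on K) (gen_poly \<alpha> p)"
    by (intro integrable_continuous_K continuous_gen_poly)
  have P_nonneg: "AE x in leb_on K. gen_poly \<alpha> p x \<ge> 0"
    using p by (intro AE_I2) (auto simp: closure_pos_cone)
  have "m \<noteq> 0"
  proof
    assume "m = 0"
    then have "AE x in leb_on K. gen_poly \<alpha> p x = gen_poly \<alpha> 0 x"
      using integral_nonneg_eq_0_iff_AE[OF int_P P_nonneg] by (simp add: m_def)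
    then show False using gen_poly_AE_eqD p by blast
  qed
  then have m: "m > 0" using integral_nonneg_AE[OF P_nonneg] by (simp add: m_def)
  \<comment> \<open>Every ray of the open cone meets the slice, so the first-order condition there
    reaches the whole open cone by scaling.\<close>
  have c_pos: "c \<bullet> r > 0" and rescale: "(m / (c \<bullet> r)) *\<^sub>R r \<in> slice c m \<inter> pos_cone K \<alpha>"
    if r: "r \<in> pos_cone K \<alpha>" for r
  proof -
    have "gen_poly \<alpha> r x > 0" if "x \<in> K" for x using r that by (auto simp: pos_cone_def)
    then have "r \<noteq> 0" using K_nonempty by fastforce
    then show *: "c \<bullet> r > 0"
      using c r closure_subset[of "pos_cone K \<alpha>"] by (auto simp: dual_cone_def)
    then have "m / (c \<bullet> r) > 0" using m by simp
    then have "(m / (c \<bullet> r)) *\<^sub>R r \<in> pos_cone K \<alpha>"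
      using r unfolding pos_cone_def by (simp del: times_divide_eq_left)
    then show "(m / (c \<bullet> r)) *\<^sub>R r \<in> slice c m \<inter> pos_cone K \<alpha>"
      using * closure_subset[of "pos_cone K \<alpha>"] by (auto simp: slice_def)
  qed
  obtain s where s: "s \<in> pos_cone K \<alpha>" using pos_cone_nonempty by blast
  have p': "p \<in> closure (pos_cone K \<alpha>)" using p by simp
  obtain q where q: "q \<in> slice c m"
    and int_q: "integrable (leb_on K) (\<lambda>x. gen_poly \<alpha> p x * ln (gen_poly \<alpha> q x))"
    and max: "\<forall>r\<in>slice c m. integrable (leb_on K) (\<lambda>x. gen_poly \<alpha> p x * ln (gen_poly \<alpha> r x)) \<longrightarrow>
      (\<integral>x. gen_poly \<alpha> p x * ln (gen_poly \<alpha> r x) \<partial>leb_on K)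
        \<le> (\<integral>x. gen_poly \<alpha> p x * ln (gen_poly \<alpha> q x) \<partial>leb_on K)"
    using slice_maximizer[OF c p' m rescale[OF s]] by blast
  note var = slice_maximizer_variation[OF p' m q int_q max, folded m_def]
  have q': "q \<in> closure (pos_cone K \<alpha>) - {0}" and cq: "c \<bullet> q = m"
    using q m by (auto simp: slice_def)
  define h where "h x = gen_poly \<alpha> p x / gen_poly \<alpha> q x" for x
  \<comment> \<open>The variation at the rescaled \<open>s\<close> makes \<open>R P / Q\<close>
    integrable; multiplication by the continuous quotient of \<open>\<alpha> k\<close> and
    \<open>R\<close> turns it into the required integrand.\<close>
  have int_h: "integrable (leb_on K) (\<lambda>x. \<alpha> k x * h x)" for k
  proof -
    let ?s = "(m / (c \<bullet> s)) *\<^sub>R s"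
    have pos: "gen_poly \<alpha> ?s x > 0" if "x \<in> K" for x
      using rescale[OF s] that by (simp add: pos_cone_def)
    then have "continuous_on K (\<lambda>x. \<alpha> k x / gen_poly \<alpha> ?s x)"
      by (intro continuous_intros continuous_gen_poly continuous_\<alpha>) force
    from integrable_continuous_mult[OF this var(1)[OF rescale[OF s]]]
    show ?thesis
      by (rule Bochner_Integration.integrable_cong[THEN iffD1, rotated -1])
         (use pos in \<open>force simp: h_def\<close>)+
  qed
  define c' where "c' = c - (\<chi> k. \<integral>x. \<alpha> k x * h x \<partial>leb_on K)"
  have c'_inner: "c' \<bullet> r = c \<bullet> r - (\<integral>x. gen_poly \<alpha> r x * h x \<partial>leb_on K)" for r
    using integral_gen_poly_mult(2)[where \<alpha> = \<alpha> and s = r, OF int_h]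
    by (simp add: c'_def inner_diff_left inner_commute[of r])
  have nonneg: "c' \<bullet> r \<ge> 0" if r: "r \<in> pos_cone K \<alpha>" for r
  proof -
    have "(m / (c \<bullet> r)) * (c' \<bullet> r) = c' \<bullet> ((m / (c \<bullet> r)) *\<^sub>R r)" by simp
    also have "\<dots> \<ge> 0"
      using var(2)[OF rescale[OF r]] c_pos[OF r] unfolding c'_inner h_def by simp
    finally show ?thesis using c_pos[OF r] m by (simp add: zero_le_mult_iff zero_le_divide_iff)
  qed
  have c'q: "c' \<bullet> q = 0"
  proof -
    have "(\<integral>x. gen_poly \<alpha> q x * h x \<partial>leb_on K) = m"
      unfolding m_def
    proof (rule integral_cong_AE)
      show "(\<lambda>x. gen_poly \<alpha> q x * h x) \<in> borel_measurable (leb_on K)"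
        unfolding h_def by measurable
      show "AE x in leb_on K. gen_poly \<alpha> q x * h x = gen_poly \<alpha> p x"
        using AE_gen_poly_pos[OF q'] by eventually_elim (simp add: h_def)
    qed measurable
    then show ?thesis by (simp add: c'_inner cq)
  qed
  have closure_nonneg: "c' \<bullet> r \<ge> 0" if "r \<in> closure (pos_cone K \<alpha>)" for r
  proof -
    have "closure (pos_cone K \<alpha>) \<subseteq> {r. c' \<bullet> r \<ge> 0}"
      by (intro closure_minimal closed_Collect_le continuous_intros) (use nonneg in auto)
    then show ?thesis using that by auto
  qed
  \<comment> \<open>Adding a small positive multiple of \<open>c\<close>, which is strictly positive
    on the nonzero closed cone, turns nonnegativity into strict positivity.\<close>
  have "c' \<in> closure (dual_cone K \<alpha>)"
    unfolding closure_sequential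
  proof (intro exI conjI allI)
    show "c' + inverse (real (Suc n)) *\<^sub>R c \<in> dual_cone K \<alpha>" for n
      using c closure_nonneg
      by (auto simp: dual_cone_def inner_add_left intro!: add_nonneg_pos mult_pos_pos)
    have "(\<lambda>n. c' + inverse (real (Suc n)) *\<^sub>R c) \<longlonglongrightarrow> c' + 0 *\<^sub>R c"
      by (intro tendsto_intros LIMSEQ_inverse_real_of_nat)
    then show "(\<lambda>n. c' + inverse (real (Suc n)) *\<^sub>R c) \<longlonglongrightarrow> c'" by simp
  qed
  moreover have "c' \<notin> dual_cone K \<alpha>" using c'q q' unfolding dual_cone_def by force
  ultimately have "moment_solution K \<alpha> c p c' q"
    unfolding moment_solution_def dual_cone_boundary_def
    using q' int_h singular_representation[OF nonneg _ c'q]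
    by (auto simp: c'_def h_def)
  then show thesis by (rule that)
qed

end

theorem theorem5p1:
  fixes K :: "(real^'d) set"
    and \<alpha> :: "'n::finite \<Rightarrow> real^'d \<Rightarrow> real"
    and c p :: "real^'n"
  assumes "compact K"
    and "interior K \<noteq> {}"
    and "closure (interior K) = K"
    and "\<And>k. continuous_on K (\<alpha> k)"
    and "lin_indep_on K \<alpha>"
    and "\<And>r. r \<in> closure (pos_cone K \<alpha>) - {0} \<Longrightarrow> {x\<in>K. gen_poly \<alpha> r x = 0} \<in> null_sets lborel"
    and "c \<in> dual_cone K \<alpha>"
    and "p \<in> closure (pos_cone K \<alpha>) - {0}"
  shows "(\<exists>!z. case z of (c', q) \<Rightarrow> moment_solution K \<alpha> c p c' q) \<and>
         (\<forall>c' q. moment_solution K \<alpha> c p c' q \<longrightarrow>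
            (\<forall>r. is_arg_min (J_fun K \<alpha> c p) (\<lambda>s. s \<in> closure (pos_cone K \<alpha>)) r \<longleftrightarrow> r = q))"
proof -
  \<comment> \<open>The closure of the empty set is empty, yet it would contain
    \<open>p\<close>.\<close>
  have "pos_cone K \<alpha> \<noteq> {}" using assms(8) by auto
  then interpret moment_cone K \<alpha>
    using assms(1-6) by unfold_locales
  obtain c0 q0 where sol: "moment_solution K \<alpha> c p c0 q0"
    using moment_solution_exists[OF assms(7,8)] by blast
  have "\<exists>!z. case z of (c', q) \<Rightarrow> moment_solution K \<alpha> c p c' q"
  proof (rule ex1I[of _ "(c0, q0)"])
    show "z = (c0, q0)" if "case z of (c', q) \<Rightarrow> moment_solution K \<alpha> c p c' q" for z
      using that sol moment_solution_unique[OF _ _ assms(8)] by (cases z) auto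
  qed (use sol in simp)
  moreover have "is_arg_min (J_fun K \<alpha> c p) (\<lambda>s. s \<in> closure (pos_cone K \<alpha>)) r \<longleftrightarrow> r = q"
    if q: "moment_solution K \<alpha> c p c' q" for c' q r
  proof -
    have "q \<in> closure (pos_cone K \<alpha>)" using q by (simp add: moment_solution_def)
    moreover have "J_fun K \<alpha> c p q < J_fun K \<alpha> c p s"
      if "s \<in> closure (pos_cone K \<alpha>)" "s \<noteq> q" for s
      using moment_solution_strict_min[OF q assms(8)] that by blast
    ultimately show ?thesis unfolding is_arg_min_def by (metis order.asym order.irrefl)
  qed
  ultimately show ?thesis by blast
qed

end
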